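(* Let $M$ be a sparse paving matroid of rank $r$, let $k\geq 2$ be an integer, and let $S$ be a multiset of size $kr$ whose elements lie in $E(M)$. Then the graph $G_M(S)$ is connected.
   Context: A matroid $M$ of rank $r$ is sparse paving if every nonspanning circuit of $M$ is a hyperplane; equivalently, every $r$-element subset of $E(M)$ is either a basis or a circuit-hyperplane. The graph $G_M(S)$ is defined as follows: its vertices are all multisets $\{A_1,\dots,A_k\}$ of $k$ bases of $M$ whose multiset union is $S$; vertices $\mathcal{A}$ and $\mathcal{B}=\{B_1,\dots,B_k\}$ are adjacent if, for some two bases $B_i,B_j$ in $\mathcal{B}$ and elements $b_i\in B_i-B_j$, $b_j\in B_j-B_i$, the multiset $\mathcal{A}$ is obtained from $\mathcal{B}$ by replacing $B_i$ by $(B_i-b_i)\cup\{b_j\}$ and $B_j$ by $(B_j-b_j)\cup\{b_i\}$ (a symmetric exchange). The graph may be empty (an empty graph is regarded as connected). *)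

theory Defs
  imports Main "HOL-Library.Multiset"
begin

text \<open>A matroid on a finite ground set E, given by its set of bases.\<close>
definition matroid_bases :: "'a set \<Rightarrow> 'a set set \<Rightarrow> bool" where
  "matroid_bases E \<B> \<longleftrightarrow> finite E \<and> \<B> \<noteq> {} \<and> (\<forall>B\<in>\<B>. B \<subseteq> E) \<and>
     (\<forall>B1\<in>\<B>. \<forall>B2\<in>\<B>. \<forall>x\<in>B1 - B2. \<exists>y\<in>B2 - B1. insert y (B1 - {x}) \<in> \<B>)"

definition m_indep :: "'a set set \<Rightarrow> 'a set \<Rightarrow> bool" where
  "m_indep \<B> X \<longleftrightarrow> (\<exists>B\<in>\<B>. X \<subseteq> B)"

text \<open>Rank function: size of a largest independent subset of X.\<close>
definition m_rank :: "'a set set \<Rightarrow> 'a set \<Rightarrow> nat" where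
  "m_rank \<B> X = Max ((\<lambda>B. card (X \<inter> B)) ` \<B>)"

definition m_circuit :: "'a set \<Rightarrow> 'a set set \<Rightarrow> 'a set \<Rightarrow> bool" where
  "m_circuit E \<B> C \<longleftrightarrow> C \<subseteq> E \<and> \<not> m_indep \<B> C \<and> (\<forall>x\<in>C. m_indep \<B> (C - {x}))"

definition m_flat :: "'a set \<Rightarrow> 'a set set \<Rightarrow> 'a set \<Rightarrow> bool" where
  "m_flat E \<B> F \<longleftrightarrow> F \<subseteq> E \<and> (\<forall>e\<in>E - F. m_rank \<B> (insert e F) > m_rank \<B> F)"

text \<open>Hyperplane: a flat of rank r(M) - 1.\<close>
definition m_hyperplane :: "'a set \<Rightarrow> 'a set set \<Rightarrow> 'a set \<Rightarrow> bool" where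
  "m_hyperplane E \<B> H \<longleftrightarrow> m_flat E \<B> H \<and> m_rank \<B> H + 1 = m_rank \<B> E"

text \<open>Sparse paving: every nonspanning circuit is a hyperplane.\<close>
definition sparse_paving :: "'a set \<Rightarrow> 'a set set \<Rightarrow> bool" where
  "sparse_paving E \<B> \<longleftrightarrow> matroid_bases E \<B> \<and>
     (\<forall>C. m_circuit E \<B> C \<and> m_rank \<B> C < m_rank \<B> E \<longrightarrow> m_hyperplane E \<B> C)"

text \<open>Vertices of G_M(S): multisets of k bases whose multiset union is S.\<close>
definition GM_vertices :: "'a set set \<Rightarrow> nat \<Rightarrow> 'a multiset \<Rightarrow> 'a set multiset set" where
  "GM_vertices \<B> k S = {\<A>. size \<A> = k \<and> set_mset \<A> \<subseteq> \<B> \<and>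
      sum_mset (image_mset mset_set \<A>) = S}"

text \<open>A is obtained from B by a symmetric exchange.\<close>
definition sym_exchange :: "'a set multiset \<Rightarrow> 'a set multiset \<Rightarrow> bool" where
  "sym_exchange \<A> \<B>' \<longleftrightarrow> (\<exists>Bi Bj bi bj. {#Bi, Bj#} \<subseteq># \<B>' \<and> bi \<in> Bi - Bj \<and> bj \<in> Bj - Bi \<and>
      \<A> = \<B>' - {#Bi, Bj#} + {#insert bj (Bi - {bi}), insert bi (Bj - {bj})#})"

definition GM_edges :: "'a set set \<Rightarrow> nat \<Rightarrow> 'a multiset \<Rightarrow> ('a set multiset \<times> 'a set multiset) set" where
  "GM_edges \<B> k S = {(\<A>, \<B>'). \<A> \<in> GM_vertices \<B> k S \<and> \<B>' \<in> GM_vertices \<B> k S \<and>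
      (sym_exchange \<A> \<B>' \<or> sym_exchange \<B>' \<A>)}"

text \<open>Connectedness (the empty graph counts as connected).\<close>
definition GM_connected :: "'a set set \<Rightarrow> nat \<Rightarrow> 'a multiset \<Rightarrow> bool" where
  "GM_connected \<B> k S \<longleftrightarrow> (\<forall>\<A>\<in>GM_vertices \<B> k S. \<forall>\<B>'\<in>GM_vertices \<B> k S.
      (\<A>, \<B>') \<in> (GM_edges \<B> k S)\<^sup>*)"

end

theory Submission
  imports Defs
begin

text \<open>In a sparse paving matroid of rank \<open>r\<close>, two \<open>r\<close>-sets that differ by a single exchange are
  never both nonbases, so few exchanges are blocked. Given two vertices of the graph, with chosen
  members \<open>X\<close> of the first and \<open>Y\<close> of the second, one decreases \<open>|X - Y|\<close> by moves on either side
  until \<open>X = Y\<close>, and then removes this common basis. To decrease, choose \<open>a \<in> X - Y\<close> and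
  \<open>c \<in> Y - X\<close> such that both \<open>X - a + c\<close> and \<open>Y - c + a\<close> are bases; counting multiplicities
  of \<open>a\<close> and \<open>c\<close> gives, up to symmetry, another member \<open>W\<close> of the first vertex with \<open>c \<in> W\<close> and
  \<open>a \<notin> W\<close>. If \<open>N = W - c + a\<close> is a nonbasis and some other member differs from \<open>N\<close> in at least two
  elements, an exchange of that member with \<open>W\<close> unblocks the move. Otherwise counting incidences
  with \<open>N\<close> forces \<open>|X - Y| + 2 \<le> |X - Y - W| + |(Y - X) \<inter> W|\<close>, and then \<open>X\<close> and \<open>W\<close> alone suffice:
  either one of the two sets on the right has at least three elements and some exchange between them
  is not blocked, or all of \<open>X - Y\<close> and \<open>Y - X\<close> can be exchanged.\<close>

section \<open>Exchanges and the common size of bases\<close>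

abbreviation exch :: "'a set \<Rightarrow> 'a \<Rightarrow> 'a \<Rightarrow> 'a set" where
  "exch X x y \<equiv> insert y (X - {x})"

lemma card_exch: "finite X \<Longrightarrow> x \<in> X \<Longrightarrow> y \<notin> X \<Longrightarrow> card (exch X x y) = card X"
  by (metis DiffE card_Suc_Diff1 card_insert_disjoint finite_Diff)

text \<open>Exchanging towards \<open>B2\<close> keeps the size of \<open>B1\<close> and shrinks
  \<open>B1 - B2\<close>. If \<open>B1 \<subseteq> B2\<close>, an element of \<open>B2 - B1\<close>
  would need a replacement in the empty set \<open>B1 - B2\<close>.\<close>

lemma matroid_bases_card_eq:
  assumes "matroid_bases E \<B>" "B1 \<in> \<B>" "B2 \<in> \<B>"
  shows "card B1 = card B2"
  using assms(2)
proof (induction "card (B1 - B2)" arbitrary: B1 rule: less_induct)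
  case less
  have fin: "finite B1" "finite B2"
    using assms less.prems by (meson matroid_bases_def finite_subset)+
  show ?case
  proof (cases "B1 \<subseteq> B2")
    case True
    then have "\<not> (\<exists>x. x \<in> B2 - B1)"
      using assms less.prems unfolding matroid_bases_def by blast
    then have "B1 = B2" using True by blast
    then show ?thesis by simp
  next
    case False
    then obtain x where x: "x \<in> B1 - B2" by blast
    then obtain y where y: "y \<in> B2 - B1" "exch B1 x y \<in> \<B>"
      using assms less.prems unfolding matroid_bases_def by blast
    have "exch B1 x y - B2 = B1 - B2 - {x}" using y by auto
    then have "card (exch B1 x y - B2) < card (B1 - B2)"
      using fin x by (metis card_Diff1_less finite_Diff)
    then have "card (exch B1 x y) = card B2"
      using less.hyps y by blast
    then show ?thesis using card_exch[of B1 x y] fin x y by auto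
  qed
qed

section \<open>Walks by symmetric exchanges\<close>

text \<open>Walks without reference to \<open>k\<close> and \<open>S\<close>: size, consisting of
  bases, and multiset union all persist along a walk, so membership in the graph has to be known
  only at its start.\<close>

inductive reach :: "'a set set \<Rightarrow> 'a set multiset \<Rightarrow> 'a set multiset \<Rightarrow> bool"
  for \<B> A where
  refl: "reach \<B> A A"
| step: "reach \<B> A (add_mset X (add_mset W T)) \<Longrightarrow> x \<in> X - W \<Longrightarrow> w \<in> W - X \<Longrightarrow>
    exch X x w \<in> \<B> \<Longrightarrow> exch W w x \<in> \<B> \<Longrightarrow>
    reach \<B> A (add_mset (exch X x w) (add_mset (exch W w x) T))"

lemma reach_trans: "reach \<B> B C \<Longrightarrow> reach \<B> A B \<Longrightarrow> reach \<B> A C"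
  by (induction rule: reach.induct) (auto intro: reach.intros)

lemma reach_add_mset: "reach \<B> A B \<Longrightarrow> reach \<B> (add_mset C A) (add_mset C B)"
proof (induction rule: reach.induct)
  case (step X W T x w)
  have "reach \<B> (add_mset C A) (add_mset X (add_mset W (add_mset C T)))"
    using step.IH by (simp add: add_mset_commute)
  from reach.step[OF this step.hyps(2-5)] show ?case
    by (simp add: add_mset_commute)
qed (rule reach.refl)

lemma reach_size: "reach \<B> A B \<Longrightarrow> size B = size A"
  by (induction rule: reach.induct) auto

lemma reach_bases: "reach \<B> A B \<Longrightarrow> set_mset A \<subseteq> \<B> \<Longrightarrow> set_mset B \<subseteq> \<B>"
  by (induction rule: reach.induct) auto

abbreviation msum :: "'a set multiset \<Rightarrow> 'a multiset" where
  "msum A \<equiv> sum_mset (image_mset mset_set A)"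

lemma mset_set_exch:
  assumes "finite X" "finite W" "x \<in> X - W" "w \<in> W - X"
  shows "mset_set (exch X x w) + mset_set (exch W w x) = mset_set X + mset_set W"
proof (rule multiset_eqI)
  fix z
  show "count (mset_set (exch X x w) + mset_set (exch W w x)) z
      = count (mset_set X + mset_set W) z"
    using assms by (auto simp: count_mset_set')
qed

lemma reach_msum:
  "reach \<B> A B \<Longrightarrow> \<forall>X\<in>\<B>. finite X \<Longrightarrow> set_mset A \<subseteq> \<B> \<Longrightarrow> msum B = msum A"
proof (induction rule: reach.induct)
  case (step X W T x w)
  have "finite X" "finite W"
    using reach_bases[OF step.hyps(1)] step.prems by auto
  then show ?case using mset_set_exch[of X W x w] step
    by (simp add: add.assoc[symmetric] del: mset_set.insert)
qed simp

lemma reach_GM_edges: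
  assumes "reach \<B> A B" "\<forall>X\<in>\<B>. finite X" "A \<in> GM_vertices \<B> k S"
  shows "(A, B) \<in> (GM_edges \<B> k S)\<^sup>*"
  using assms(1)
proof (induction rule: reach.induct)
  case (step X W T x w)
  let ?B = "add_mset X (add_mset W T)"
  let ?C = "add_mset (exch X x w) (add_mset (exch W w x) T)"
  have C: "reach \<B> A ?C" using step.hyps by (rule reach.step)
  have V: "D \<in> GM_vertices \<B> k S" if "reach \<B> A D" for D
    using that assms(2,3) reach_size[OF that] reach_bases[OF that] reach_msum[OF that]
    by (simp add: GM_vertices_def)
  have "sym_exchange ?C ?B"
    unfolding sym_exchange_def using step.hyps(2,3)
    by (intro exI[of _ X] exI[of _ W] exI[of _ x] exI[of _ w]) simp
  then have "(?B, ?C) \<in> GM_edges \<B> k S"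
    using V[OF step.hyps(1)] V[OF C] by (auto simp: GM_edges_def)
  with step.IH show ?case by (rule rtrancl_into_rtrancl)
qed simp

section \<open>Counting incidences in multiset unions\<close>

lemma count_msum:
  "\<forall>V\<in>#A. finite V \<Longrightarrow> count (msum A) z = (\<Sum>V\<in>#A. if z \<in> V then 1 else 0)"
  by (induction A) auto

text \<open>The left side depends on \<open>A\<close> only through its multiset union, so two
  vertices of the same graph have the same total incidence with \<open>N\<close>.\<close>

lemma size_filter_msum:
  "\<forall>V\<in>#A. finite V \<Longrightarrow> size (filter_mset (\<lambda>z. z \<in> N) (msum A)) = (\<Sum>V\<in>#A. card (V \<inter> N))"
  by (induction A) (auto simp: filter_mset_mset_set Int_def)

lemma le_add_card_remove: "card A \<le> card (A - {x}) + 1"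
  by (cases "finite A"; cases "x \<in> A") (simp_all add: card_Diff_singleton)

lemma card_2_containing: "card A = 2 \<Longrightarrow> x \<in> A \<Longrightarrow> \<exists>y. A = {x, y} \<and> x \<noteq> y"
  by (auto simp: card_2_iff)

lemma card_ge2_obtain:
  assumes "card A \<ge> 2"
  obtains x y where "x \<in> A" "y \<in> A" "x \<noteq> y"
proof -
  obtain B where "B \<subseteq> A" "card B = 2" by (rule obtain_subset_with_card_n[OF assms])
  then obtain x y where "B = {x, y}" "x \<noteq> y" by (meson card_2_iff)
  then show ?thesis using \<open>B \<subseteq> A\<close> that[of x y] by blast
qed

lemma card_ge3_obtain:
  assumes "card A \<ge> 3"
  obtains x y z where "x \<in> A" "y \<in> A" "z \<in> A" "x \<noteq> y" "x \<noteq> z" "y \<noteq> z"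
proof -
  obtain B where "B \<subseteq> A" "card B = 3" by (rule obtain_subset_with_card_n[OF assms])
  then obtain x y z where "B = {x, y, z}" "x \<noteq> y" "y \<noteq> z" "x \<noteq> z" by (meson card_3_iff)
  then show ?thesis using \<open>B \<subseteq> A\<close> that[of x y z] by blast
qed

section \<open>Families of bases whose nonbases are pairwise far apart\<close>

text \<open>The nonbases form a stable set in the Johnson graph on the \<open>r\<close>-subsets of
  \<open>E\<close>: for distinct sets of equal size, \<open>X - Y \<subseteq> {t}\<close> says that
  they are one exchange apart.\<close>

locale stable_nonbases =
  fixes E :: "'a set" and \<B> :: "'a set set" and r :: nat
  assumes finite_ground: "finite E"
    and basis_subset: "B \<in> \<B> \<Longrightarrow> B \<subseteq> E"
    and basis_card: "B \<in> \<B> \<Longrightarrow> card B = r"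
    and nonbases_apart: "\<lbrakk>X \<subseteq> E; card X = r; X \<notin> \<B>;
      Y \<subseteq> E; card Y = r; X \<noteq> Y; X - Y \<subseteq> {t}\<rbrakk> \<Longrightarrow> Y \<in> \<B>"
begin

lemma basis_finite: "B \<in> \<B> \<Longrightarrow> finite B"
  using basis_subset finite_ground finite_subset by blast

definition nonbasis :: "'a set \<Rightarrow> bool" where
  "nonbasis X \<longleftrightarrow> X \<subseteq> E \<and> card X = r \<and> X \<notin> \<B>"

lemma nonbasis_apart:
  "nonbasis X \<Longrightarrow> nonbasis Y \<Longrightarrow> X - Y \<subseteq> {t} \<Longrightarrow> X = Y"
  unfolding nonbasis_def using nonbases_apart by blast

lemma nonbasis_apartE:
  "nonbasis X \<Longrightarrow> nonbasis Y \<Longrightarrow> X - Y \<subseteq> {t} \<Longrightarrow> u \<in> Y \<Longrightarrow> u \<notin> X \<Longrightarrow> False"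
  using nonbasis_apart by blast

lemma exch_nonbasis:
  assumes "X \<in> \<B>" "x \<in> X" "y \<in> E" "y \<notin> X" "exch X x y \<notin> \<B>"
  shows "nonbasis (exch X x y)"
  using assms basis_subset[of X] basis_card[of X] basis_finite[of X] card_exch[of X x y]
  by (auto simp: nonbasis_def)

lemma basis_diff_card:
  assumes "X \<in> \<B>" "card Y = r" "Y \<subseteq> E" shows "card (X - Y) = card (Y - X)"
  using assms basis_card[of X] basis_finite[of X] finite_subset[OF _ finite_ground, of Y]
  by (simp add: card_Diff_subset_Int Int_commute)

section \<open>Unblocked exchanges between two bases\<close>

text \<open>For fixed \<open>y\<close> the sets \<open>exch X x y\<close> are pairwise one exchange
  apart, so at most one is a nonbasis; likewise for the sets \<open>exch W y x\<close>. Hence at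
  most two elements of \<open>R\<close> are blocked.\<close>

lemma exchange_grid_aux:
  assumes "X \<in> \<B>" "W \<in> \<B>" "R \<subseteq> X - W" "y \<in> W - X" "card R \<ge> 3"
  shows "\<exists>x\<in>R. exch X x y \<in> \<B> \<and> exch W y x \<in> \<B>"
proof (rule ccontr)
  assume contra: "\<not> ?thesis"
  obtain x1 x2 x3 where x: "x1 \<in> R" "x2 \<in> R" "x3 \<in> R" "x1 \<noteq> x2" "x1 \<noteq> x3" "x2 \<noteq> x3"
    using assms(5) by (rule card_ge3_obtain)
  have E: "X \<subseteq> E" "W \<subseteq> E" using assms basis_subset by auto
  have bad: "nonbasis (exch X x y) \<or> nonbasis (exch W y x)" if "x \<in> R" for x
    using contra that exch_nonbasis[of X x y] exch_nonbasis[of W y x] assms E by blast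
  have 1: "\<not> (nonbasis (exch X x y) \<and> nonbasis (exch X x' y))" if "x \<in> R" "x' \<in> R" "x \<noteq> x'" for x x'
    using nonbasis_apartE[of "exch X x y" "exch X x' y" x' x] that assms by blast
  have 2: "\<not> (nonbasis (exch W y x) \<and> nonbasis (exch W y x'))" if "x \<in> R" "x' \<in> R" "x \<noteq> x'" for x x'
    using nonbasis_apartE[of "exch W y x" "exch W y x'" x x'] that assms by blast
  show False
    using bad[of x1] bad[of x2] bad[of x3] 1[of x1 x2] 1[of x1 x3] 1[of x2 x3]
      2[of x1 x2] 2[of x1 x3] 2[of x2 x3] x by metis
qed

lemma exchange_grid:
  assumes "X \<in> \<B>" "W \<in> \<B>" "R \<subseteq> X - W" "Y \<subseteq> W - X" "R \<noteq> {}" "Y \<noteq> {}"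
    and "card R \<ge> 3 \<or> card Y \<ge> 3"
  shows "\<exists>x\<in>R. \<exists>y\<in>Y. exch X x y \<in> \<B> \<and> exch W y x \<in> \<B>"
  using assms(7)
proof
  assume "card R \<ge> 3"
  then show ?thesis using exchange_grid_aux[of X W R] assms(1-6) by blast
next
  assume "card Y \<ge> 3"
  then show ?thesis using exchange_grid_aux[of W X Y] assms(1-6) by blast
qed

lemma symmetric_exchange:
  assumes X: "X \<in> \<B>" and W: "W \<in> \<B>" and "X \<noteq> W"
  shows "\<exists>x\<in>X - W. \<exists>y\<in>W - X. exch X x y \<in> \<B> \<and> exch W y x \<in> \<B>"
proof -
  have E: "X \<subseteq> E" "W \<subseteq> E" using assms basis_subset by auto
  have fin: "finite X" "finite W" using assms basis_finite by auto
  have eq: "card (X - W) = card (W - X)"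
    using X W E basis_card by (intro basis_diff_card) auto
  have ne: "X - W \<noteq> {}" "W - X \<noteq> {}"
    using eq \<open>X \<noteq> W\<close> fin by (metis Diff_eq_empty_iff card_0_eq card.empty finite_Diff subset_antisym)+
  consider "card (X - W) = 1" | "card (X - W) = 2" | "card (X - W) \<ge> 3"
    using ne fin by (metis card_0_eq finite_Diff One_nat_def Suc_leI le_neq_implies_less not_gr0 numeral_2_eq_2 numeral_3_eq_3)
  then show ?thesis
  proof cases
    case 1
    then obtain x where x: "X - W = {x}" using card_1_singletonE by blast
    obtain y where y: "W - X = {y}" using 1 eq card_1_singletonE by metis
    have "exch X x y = W" "exch W y x = X" using x y by blast+
    then show ?thesis using x y X W by auto
  next
    case 2
    then obtain x x' where x: "X - W = {x, x'}" "x \<noteq> x'" by (meson card_2_iff)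
    obtain y y' where y: "W - X = {y, y'}" "y \<noteq> y'" using 2 eq by (metis card_2_iff)
    show ?thesis
    proof (rule ccontr)
      assume contra: "\<not> ?thesis"
      have bad: "nonbasis (exch X u v) \<or> nonbasis (exch W v u)" if "u \<in> X - W" "v \<in> W - X" for u v
        using contra that exch_nonbasis[of X u v] exch_nonbasis[of W v u] X W E by blast
      \<comment> \<open>An exchange on the \<open>W\<close> side gives the same set as the
        complementary exchange on the \<open>X\<close> side. Blocking all pairs would therefore need
        a nonbasis on each diagonal of a four-cycle, but sets on different diagonals are
        adjacent.\<close>
      have sw: "exch W y x = exch X x' y'" "exch W y' x = exch X x' y"
        using x y by blast+
      have "nonbasis (exch X x y) \<or> nonbasis (exch X x' y')" "nonbasis (exch X x y') \<or> nonbasis (exch X x' y)"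
        using bad[of x y] bad[of x y'] sw x y by auto
      moreover have "\<not> (nonbasis (exch X x y) \<and> nonbasis (exch X x y'))"
        using nonbasis_apartE[of "exch X x y" "exch X x y'" y y'] x y by blast
      moreover have "\<not> (nonbasis (exch X x y) \<and> nonbasis (exch X x' y))"
        using nonbasis_apartE[of "exch X x y" "exch X x' y" x' x] x y by blast
      moreover have "\<not> (nonbasis (exch X x' y') \<and> nonbasis (exch X x y'))"
        using nonbasis_apartE[of "exch X x' y'" "exch X x y'" x x'] x y by blast
      moreover have "\<not> (nonbasis (exch X x' y') \<and> nonbasis (exch X x' y))"
        using nonbasis_apartE[of "exch X x' y'" "exch X x' y" y' y] x y by blast
      ultimately show False by blast
    qed
  next
    case 3
    then show ?thesis using exchange_grid[of X W "X - W" "W - X"] X W ne by blast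
  qed
qed

text \<open>The exchange avoids \<open>c\<close> and \<open>a\<close>, so the new set \<open>exch W x y\<close> still admits replacing \<open>c\<close> by
  \<open>a\<close>; the result is adjacent to the nonbasis \<open>exch W c a\<close> and hence a basis.\<close>

lemma avoiding_exchange:
  assumes W: "W \<in> \<B>" and V: "V \<in> \<B>" and c: "c \<in> W" and a: "a \<notin> W" "a \<in> E"
    and N: "exch W c a \<notin> \<B>" and far: "card (V - exch W c a) \<ge> 2"
  shows "\<exists>x\<in>W - V. \<exists>y\<in>V - W. x \<noteq> c \<and> y \<noteq> a \<and> exch W x y \<in> \<B> \<and> exch V y x \<in> \<B>"
proof -
  have E: "V \<subseteq> E" "W \<subseteq> E" using assms basis_subset by auto
  have fin: "finite V" "finite W" using assms basis_finite by auto
  let ?N = "exch W c a"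
  have hN: "nonbasis ?N" using exch_nonbasis W c a N by blast
  have eq: "card (?N - V) = card (V - ?N)"
    using basis_diff_card[of V ?N] V hN by (simp add: nonbasis_def)
  show ?thesis
  proof (cases "a \<notin> V \<and> c \<in> V")
    case True
    have "W \<noteq> V"
    proof
      assume "W = V"
      then have "V - ?N \<subseteq> {c}" by blast
      then have "card (V - ?N) \<le> 1" using card_mono[of "{c}" "V - ?N"] by simp
      with far show False by simp
    qed
    \<comment> \<open>Since \<open>c \<in> V\<close> and \<open>a \<notin> V\<close>, no exchange
      between \<open>W\<close> and \<open>V\<close> can involve them.\<close>
    from symmetric_exchange[OF W V this] obtain x y where
      "x \<in> W - V" "y \<in> V - W" "exch W x y \<in> \<B>" "exch V y x \<in> \<B>"
      by blast
    moreover have "x \<noteq> c" "y \<noteq> a" using True calculation by blast+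
    ultimately show ?thesis by blast
  next
    case False
    \<comment> \<open>If \<open>a \<in> V\<close>, then \<open>?R\<close> is all of
      \<open>?N - V\<close>; if \<open>c \<notin> V\<close>, then \<open>?Y\<close> is all of
      \<open>V - ?N\<close>. So one of the two has full size \<open>card (V - ?N)\<close> and the
      other loses at most one element.\<close>
    let ?R = "W - V - {c}" and ?Y = "V - W - {a}"
    have R: "?R = ?N - V - {a}" and Y: "?Y = V - ?N - {c}" using c a by blast+
    have cR: "card ?R + 1 \<ge> card (V - ?N)" unfolding R eq[symmetric] by (rule le_add_card_remove)
    have cY: "card ?Y + 1 \<ge> card (V - ?N)" unfolding Y by (rule le_add_card_remove)
    have big: "card ?R \<ge> card (V - ?N) \<or> card ?Y \<ge> card (V - ?N)"
      unfolding R Y using False eq by auto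
    have "card ?R \<noteq> 0" "card ?Y \<noteq> 0" using cR cY far by linarith+
    then have ne: "?R \<noteq> {}" "?Y \<noteq> {}" by (metis card.empty)+
    show ?thesis
    proof (cases "card (V - ?N) \<ge> 3")
      case True
      then have "card ?R \<ge> 3 \<or> card ?Y \<ge> 3" using big by linarith
      then have "\<exists>x\<in>?R. \<exists>y\<in>?Y. exch W x y \<in> \<B> \<and> exch V y x \<in> \<B>"
        using exchange_grid[of W V ?R ?Y] ne W V by blast
      then show ?thesis by blast
    next
      case False
      then have two: "card (V - ?N) = 2" using far by simp
      \<comment> \<open>Replacing \<open>y\<close> by an element of \<open>?N\<close> leaves only
        one element \<open>z\<close> outside \<open>?N\<close>, so the result is adjacent to this
        nonbasis. Only the \<open>W\<close> side can still be blocked.\<close>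
      have VN: "exch V y x \<in> \<B>" if "x \<in> ?R" "y \<in> ?Y" for x y
      proof -
        have "card (V - ?N - {y}) = 1" using two that fin by (subst card_Diff_singleton) auto
        then obtain z where z: "V - ?N - {y} = {z}" by (rule card_1_singletonE)
        have "nonbasis (exch V y x) \<Longrightarrow> exch V y x = ?N"
          using nonbasis_apart[of "exch V y x" ?N z] hN z that by blast
        moreover have "z \<in> exch V y x" "z \<notin> ?N" using z by blast+
        ultimately have "\<not> nonbasis (exch V y x)" by blast
        then show ?thesis using exch_nonbasis[of V y x] V that E by blast
      qed
      have "\<exists>x\<in>?R. \<exists>y\<in>?Y. exch W x y \<in> \<B>"
      proof (rule ccontr)
        assume "\<not> ?thesis"
        then have bad: "nonbasis (exch W x y)" if "x \<in> ?R" "y \<in> ?Y" for x y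
          using exch_nonbasis[of W x y] W that E by blast
        from big two have "card ?R \<ge> 2 \<or> card ?Y \<ge> 2" by simp
        then show False
        proof
          assume "card ?R \<ge> 2"
          then obtain x x' where "x \<in> ?R" "x' \<in> ?R" "x \<noteq> x'" by (rule card_ge2_obtain)
          moreover obtain y where "y \<in> ?Y" using ne by blast
          ultimately show False
            using bad[of x y] bad[of x' y] nonbasis_apartE[of "exch W x y" "exch W x' y" x' x] by blast
        next
          assume "card ?Y \<ge> 2"
          then obtain y y' where "y \<in> ?Y" "y' \<in> ?Y" "y \<noteq> y'" by (rule card_ge2_obtain)
          moreover obtain x where "x \<in> ?R" using ne by blast
          ultimately show False
            using bad[of x y] bad[of x y'] nonbasis_apartE[of "exch W x y" "exch W x y'" y y'] by blast
        qed
      qed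
      then show ?thesis using VN by blast
    qed
  qed
qed

text \<open>Every single exchange between \<open>{a, a'}\<close> and \<open>{c, c'}\<close> is blocked, but each set met on a
  detour through \<open>e\<close> is adjacent to one of the blocking nonbases and is therefore a basis.\<close>

lemma double_exchange:
  assumes X: "X \<in> \<B>" and W: "W \<in> \<B>" and P: "a \<in> X - W" "a' \<in> X - W" "a \<noteq> a'"
    and Q: "c \<in> W - X" "c' \<in> W - X" "c \<noteq> c'"
    and e: "e \<in> X - W" "e \<noteq> a" "e \<noteq> a'"
    and H: "nonbasis (exch X a c')" "nonbasis (exch X a' c)" "nonbasis (exch W c a)" "nonbasis (exch W c' a')"
    and Z: "insert c (insert c' (X - {a, a'})) \<in> \<B>"
  shows "\<exists>A. reach \<B> (add_mset X (add_mset W T)) (add_mset (insert c (insert c' (X - {a, a'}))) A)"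
proof -
  have E: "X \<subseteq> E" "W \<subseteq> E" using assms basis_subset by auto
  \<comment> \<open>\<open>X\<close> trades \<open>e\<close> for \<open>c\<close>, then
    \<open>a'\<close> for \<open>c'\<close>, then \<open>a\<close> for \<open>e\<close>, while
    \<open>W\<close> makes the opposite trades. Here \<open>?X1\<close> and \<open>?X2\<close> are
    adjacent to \<open>exch X a' c\<close>, \<open>?W1\<close> and \<open>?W3\<close> to
    \<open>exch W c a\<close>, and \<open>?W2\<close> to \<open>exch W c' a'\<close>.\<close>
  let ?X1 = "exch X e c" and ?W1 = "exch W c e"
  let ?X2 = "exch ?X1 a' c'" and ?W2 = "exch ?W1 c' a'"
  let ?X3 = "exch ?X2 a e" and ?W3 = "exch ?W2 e a"
  have X1: "?X1 \<in> \<B>"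
    using exch_nonbasis[of X e c] nonbasis_apartE[OF H(2), of ?X1 e a'] X E P Q e by blast
  have W1: "?W1 \<in> \<B>"
    using exch_nonbasis[of W c e] nonbasis_apartE[OF H(3), of ?W1 a e] W E P Q e by blast
  have X2: "?X2 \<in> \<B>"
    using exch_nonbasis[of ?X1 a' c'] nonbasis_apartE[OF H(2), of ?X2 e c'] X1 E P Q e by blast
  have W2: "?W2 \<in> \<B>"
    using exch_nonbasis[of ?W1 c' a'] nonbasis_apartE[OF H(4), of ?W2 c e] W1 E P Q e by blast
  have X3: "?X3 = insert c (insert c' (X - {a, a'}))" using P Q e by blast
  have W3: "?W3 \<in> \<B>"
    using exch_nonbasis[of ?W2 e a] nonbasis_apartE[OF H(3), of ?W3 c' a'] W2 E P Q e by blast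
  have "reach \<B> (add_mset X (add_mset W T)) (add_mset ?X1 (add_mset ?W1 T))"
    by (rule reach.step[OF reach.refl]) (use X1 W1 P Q e in blast)+
  then have "reach \<B> (add_mset X (add_mset W T)) (add_mset ?X2 (add_mset ?W2 T))"
    by (rule reach.step) (use X2 W2 P Q e in blast)+
  then have "reach \<B> (add_mset X (add_mset W T)) (add_mset ?X3 (add_mset ?W3 T))"
    by (rule reach.step) (use X3 W3 Z P Q e in \<open>blast | simp\<close>)+
  then show ?thesis unfolding X3 by blast
qed

section \<open>Decreasing the distance of the chosen bases\<close>

lemma closer_exchange:
  assumes "finite X" "x \<in> X - Y" "x \<notin> W" "y \<in> Y - X" "y \<in> W"
    and "exch X x y \<in> \<B>" "exch W y x \<in> \<B>"
  shows "\<exists>X' A'. reach \<B> (add_mset X (add_mset W T)) (add_mset X' A') \<and> card (X' - Y) < card (X - Y)"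
proof -
  have "exch X x y - Y = X - Y - {x}" using assms by blast
  then have "card (exch X x y - Y) < card (X - Y)"
    using assms by (metis card_Diff1_less finite_Diff)
  moreover have "reach \<B> (add_mset X (add_mset W T)) (add_mset (exch X x y) (add_mset (exch W y x) T))"
    by (rule reach.step[OF reach.refl]) (use assms in blast)+
  ultimately show ?thesis by blast
qed

text \<open>If no member of \<open>A\<close> can be moved away from the nonbasis \<open>exch W c a\<close>, then each of them meets
  it in at least \<open>r - 1\<close> elements, while the bases in \<open>B\<close> meet it in at most \<open>r - 1\<close>.\<close>

lemma nonbasis_count:
  assumes XY: "X \<in> \<B>" "Y \<in> \<B>" and AB: "set_mset A \<subseteq> \<B>" "set_mset B \<subseteq> \<B>" "size A = size B"
    and sum: "msum (add_mset X A) = msum (add_mset Y B)"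
    and N: "nonbasis N" and near: "\<forall>V\<in>#A. card (V - N) \<le> 1"
  shows "card (X \<inter> N) \<le> card (Y \<inter> N)"
proof -
  have finN: "finite N" using N finite_ground finite_subset by (auto simp: nonbasis_def)
  have "r - 1 \<le> card (V \<inter> N)" if "V \<in># A" for V
  proof -
    have "V \<in> \<B>" "card (V - N) \<le> 1" using that AB near by auto
    then show ?thesis
      using card_Diff_subset_Int[of V N] basis_card[of V] basis_finite[of V] by simp
  qed
  then have lower: "size A * (r - 1) \<le> (\<Sum>V\<in>#A. card (V \<inter> N))"
    using sum_mset_mono[of A "\<lambda>_. r - 1" "\<lambda>V. card (V \<inter> N)"] by simp
  have "card (V \<inter> N) \<le> r - 1" if "V \<in># B" for V
  proof -
    have V: "V \<in> \<B>" using that AB by auto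
    then have "\<not> N \<subseteq> V"
      using N basis_card[of V] basis_finite[of V] card_subset_eq[of V N] by (auto simp: nonbasis_def)
    then have "card (V \<inter> N) < card N" using finN by (intro psubset_card_mono) auto
    then show ?thesis using N by (simp add: nonbasis_def)
  qed
  then have upper: "(\<Sum>V\<in>#B. card (V \<inter> N)) \<le> size B * (r - 1)"
    using sum_mset_mono[of B "\<lambda>V. card (V \<inter> N)" "\<lambda>_. r - 1"] by simp
  \<comment> \<open>Both totals are determined by the common multiset union. As \<open>A\<close> and
    \<open>B\<close> have equal size, the bounds for them leave the comparison of \<open>X\<close>
    with \<open>Y\<close>.\<close>
  have "(\<Sum>V\<in>#add_mset X A. card (V \<inter> N)) = (\<Sum>V\<in>#add_mset Y B. card (V \<inter> N))"
  proof -
    have "\<forall>V\<in>#add_mset X A. finite V" "\<forall>V\<in>#add_mset Y B. finite V"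
      using XY AB basis_finite by auto
    then show ?thesis using size_filter_msum[of _ N] sum by metis
  qed
  then show ?thesis using lower upper AB by simp
qed

text \<open>If no decrease is possible, \<open>exch W c a\<close> is a nonbasis and every member of
  \<open>A\<close> is within one element of it. This rigidity forces
  \<open>card (X - Y) = 2\<close>, where \<open>X\<close> can be carried to \<open>Y\<close> itself
  or \<open>W\<close> already equals \<open>Y\<close>.\<close>

lemma decrease_one_side:
  assumes XY: "X \<in> \<B>" "Y \<in> \<B>" and AB: "set_mset A \<subseteq> \<B>" "set_mset B \<subseteq> \<B>" "size A = size B"
    and sum: "msum (add_mset X A) = msum (add_mset Y B)"
    and a: "a \<in> X - Y" and c: "c \<in> Y - X" and Xac: "exch X a c \<in> \<B>"
    and W: "W \<in># A" "c \<in> W" "a \<notin> W"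
  shows "\<exists>X' A'. reach \<B> (add_mset X A) (add_mset X' A') \<and> card (X' - Y) < card (X - Y)"
proof (rule ccontr)
  assume contra: "\<not> ?thesis"
  have WB: "W \<in> \<B>" using W AB by auto
  have E: "X \<subseteq> E" "W \<subseteq> E" "Y \<subseteq> E" using XY WB basis_subset by auto
  have fin: "finite X" "finite W" "finite Y" using XY WB basis_finite by auto
  obtain T where A: "A = add_mset W T" using W by (meson multi_member_split)
  let ?N = "exch W c a"
  have noexch: "\<not> (exch X x y \<in> \<B> \<and> exch W y x \<in> \<B>)"
    if "x \<in> X - Y" "x \<notin> W" "y \<in> Y - X" "y \<in> W" for x y
    using closer_exchange[of X x Y W y T] that contra fin A by blast
  have "?N \<notin> \<B>" using noexch[of a c] a c W Xac by blast
  then have N: "nonbasis ?N" using exch_nonbasis[OF WB, of c a] W a E by blast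
  \<comment> \<open>A member \<open>V\<close> far from \<open>?N\<close> could exchange with
    \<open>W\<close> without touching \<open>a\<close> or \<open>c\<close>. The new
    \<open>?W'\<close> then gives \<open>exch ?W' c a\<close>, adjacent to \<open>?N\<close> and
    hence a basis, which frees the move of \<open>X\<close>.\<close>
  have near: "card (V - ?N) \<le> 1" if "V \<in># A" for V
  proof (rule ccontr)
    assume far: "\<not> card (V - ?N) \<le> 1"
    have "card (W - ?N) \<le> 1" using card_mono[of "{c}" "W - ?N"] by auto
    with far have "V \<noteq> W" by auto
    then have "V \<in># T" using that A by simp
    then obtain T' where T: "T = add_mset V T'" by (meson multi_member_split)
    have VB: "V \<in> \<B>" using that AB by auto
    obtain x y where xy: "x \<in> W - V" "y \<in> V - W" "x \<noteq> c" "y \<noteq> a"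
      "exch W x y \<in> \<B>" "exch V y x \<in> \<B>"
      using avoiding_exchange[OF WB VB, of c a] W a E \<open>?N \<notin> \<B>\<close> far by auto
    let ?W' = "exch W x y"
    have "exch ?W' c a \<in> \<B>"
      using exch_nonbasis[of ?W' c a] nonbasis_apartE[OF N, of "exch ?W' c a" x y] xy a c W E by blast
    then have "\<exists>X' A'. reach \<B> (add_mset X (add_mset ?W' (add_mset (exch V y x) T')))
        (add_mset X' A') \<and> card (X' - Y) < card (X - Y)"
      using closer_exchange[of X a Y ?W' c] a c W xy Xac fin by blast
    moreover have "reach \<B> (add_mset X A) (add_mset X (add_mset ?W' (add_mset (exch V y x) T')))"
      unfolding A T by (rule reach_add_mset, rule reach.step[OF reach.refl]) (use xy in blast)+
    ultimately show False using contra reach_trans by meson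
  qed
  \<comment> \<open>The part in \<open>X \<inter> Y\<close> cancels. Passing from \<open>W\<close>
    to \<open>?N\<close> gains \<open>a\<close> in \<open>X - Y\<close> and loses \<open>c\<close>
    in \<open>Y - X\<close>, which gives the summand 2 in \<open>ineq\<close>.\<close>
  have "card (X \<inter> ?N) \<le> card (Y \<inter> ?N)"
    using nonbasis_count[OF XY AB sum N] near by blast
  moreover have "card (X \<inter> ?N) = card (X \<inter> Y \<inter> ?N) + card ((X - Y) \<inter> ?N)"
    using fin by (subst card_Un_disjoint[symmetric]) (auto intro: arg_cong[of _ _ card])
  moreover have "card (Y \<inter> ?N) = card (X \<inter> Y \<inter> ?N) + card ((Y - X) \<inter> ?N)"
    using fin by (subst card_Un_disjoint[symmetric]) (auto intro: arg_cong[of _ _ card])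
  moreover have "(X - Y) \<inter> ?N = insert a ((X - Y) \<inter> W)" using a c by blast
  moreover have "(Y - X) \<inter> ?N = (Y - X) \<inter> W - {c}" using a by blast
  moreover have "a \<notin> (X - Y) \<inter> W" "c \<in> (Y - X) \<inter> W" using W c by auto
  moreover have "card ((Y - X) \<inter> W - {c}) + 1 = card ((Y - X) \<inter> W)"
    using fin W c card_Suc_Diff1[of "(Y - X) \<inter> W" c] by simp
  moreover have "card (X - Y) = card ((X - Y) - W) + card ((X - Y) \<inter> W)"
    using fin by (subst card_Un_disjoint[symmetric]) (auto intro: arg_cong[of _ _ card])
  ultimately have ineq: "card (X - Y) + 2 \<le> card ((X - Y) - W) + card ((Y - X) \<inter> W)"
    using fin by simp
  have eq: "card (X - Y) = card (Y - X)"
    using basis_diff_card[of X Y] XY E basis_card by simp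
  let ?P = "X - Y - W" and ?Q = "(Y - X) \<inter> W"
  have le: "card ?P \<le> card (X - Y)" "card ?Q \<le> card (X - Y)"
    unfolding eq[symmetric] using fin card_mono[of "X - Y" ?P] card_mono[of "Y - X" ?Q] eq by auto
  \<comment> \<open>An unblocked exchange between \<open>?P\<close> and \<open>?Q\<close> would be a
    decrease, so both have at most two elements. With \<open>ineq\<close> and \<open>le\<close>, all
    three sizes equal 2.\<close>
  have "\<not> (card ?P \<ge> 3 \<or> card ?Q \<ge> 3)"
    using exchange_grid[of X W ?P ?Q] XY(1) WB a c W noexch by blast
  then have two: "card (X - Y) = 2" "card ?P = 2" "card ?Q = 2"
    using ineq le by linarith+
  then have PQ: "X - Y = ?P" "Y - X = ?Q"
    using fin eq card_subset_eq[of "X - Y" ?P] card_subset_eq[of "Y - X" ?Q] by auto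
  obtain a' where a': "X - Y = {a, a'}" "a \<noteq> a'" using card_2_containing two(1) a by metis
  obtain c' where c': "Y - X = {c, c'}" "c \<noteq> c'" using card_2_containing two(1) eq c by metis
  have mem: "a \<in> X - W" "a' \<in> X - W" "c \<in> W - X" "c' \<in> W - X"
    using PQ a' c' by blast+
  have Y: "Y = insert c (insert c' (X - {a, a'}))" using a' c' by blast
  have bad: "nonbasis (exch X u v) \<or> nonbasis (exch W v u)" if "u \<in> X - Y" "v \<in> Y - X" for u v
  proof -
    have "u \<in> X - W" "v \<in> W - X" using that PQ by blast+
    then show ?thesis
      using noexch[of u v] that exch_nonbasis[OF XY(1), of u v] exch_nonbasis[OF WB, of v u] E by blast
  qed
  \<comment> \<open>Blocking alternates: a nonbasis on one side makes its neighbours bases, so the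
    next pair must be blocked on the other side.\<close>
  have 1: "nonbasis (exch X a c')"
    using bad[of a c'] nonbasis_apartE[OF N, of "exch W c' a" c' c] mem a' c' by blast
  have 2: "nonbasis (exch X a' c)"
    using bad[of a' c] nonbasis_apartE[OF N, of "exch W c a'" a a'] mem a' c' by blast
  have 3: "nonbasis (exch W c' a')"
    using bad[of a' c'] nonbasis_apartE[OF 2, of "exch X a' c'" c c'] mem a' c' by blast
  have "\<exists>A'. reach \<B> (add_mset X A) (add_mset Y A')"
  proof (cases "\<exists>e\<in>X - W. e \<noteq> a \<and> e \<noteq> a'")
    case True
    then obtain e where "e \<in> X - W" "e \<noteq> a" "e \<noteq> a'" by blast
    then show ?thesis
      using double_exchange[of X W a a' c c' e T] XY WB mem a' c' 1 2 3 N A Y by simp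
  next
    case False
    then have "X - W = {a, a'}" using mem by blast
    then have "card (W - X) = 2"
      using basis_diff_card[of X W] XY WB E basis_card a' by simp
    then have "W - X = {c, c'}"
      using mem c' fin card_subset_eq[of "W - X" "{c, c'}"] by simp
    \<comment> \<open>No exchange is made here; only the distinguished member changes from
      \<open>X\<close> to \<open>W\<close>.\<close>
    then have "W = Y" using Y \<open>X - W = {a, a'}\<close> by blast
    then have "reach \<B> (add_mset X A) (add_mset Y (add_mset X T))"
      using A reach.refl by (simp add: add_mset_commute)
    then show ?thesis by blast
  qed
  then show False using contra two by fastforce
qed

lemma count_msum_le:
  assumes "set_mset A \<subseteq> \<B>" "\<forall>W\<in>#A. c \<in> W \<longrightarrow> a \<in> W"
  shows "count (msum A) c \<le> count (msum A) a"
  using assms basis_finite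
  by (subst (1 2) count_msum) (auto intro!: sum_mset_mono)

lemma decrease:
  assumes XY: "X \<in> \<B>" "Y \<in> \<B>" "X \<noteq> Y" and AB: "set_mset A \<subseteq> \<B>" "set_mset B \<subseteq> \<B>" "size A = size B"
    and sum: "msum (add_mset X A) = msum (add_mset Y B)"
  shows "\<exists>X' A' Y' B'. reach \<B> (add_mset X A) (add_mset X' A') \<and> reach \<B> (add_mset Y B) (add_mset Y' B')
    \<and> card (X' - Y') < card (X - Y)"
proof -
  obtain a c where ac: "a \<in> X - Y" "c \<in> Y - X" "exch X a c \<in> \<B>" "exch Y c a \<in> \<B>"
    using symmetric_exchange[of X Y] XY by blast
  have fin: "finite X" "finite Y" using XY basis_finite by auto
  have cnt: "count (msum (add_mset X A)) z = count (msum (add_mset Y B)) z" for z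
    using sum by simp
  \<comment> \<open>Otherwise \<open>c\<close> occurs in \<open>A\<close> at most as often as
    \<open>a\<close>, and \<open>a\<close> in \<open>B\<close> at most as often as \<open>c\<close>.
    But \<open>X\<close> contributes only \<open>a\<close> and \<open>Y\<close> only
    \<open>c\<close>, so equal totals are impossible.\<close>
  consider W where "W \<in># A" "c \<in> W" "a \<notin> W" | W where "W \<in># B" "a \<in> W" "c \<notin> W"
  proof -
    have False if "\<forall>W\<in>#A. c \<in> W \<longrightarrow> a \<in> W" "\<forall>W\<in>#B. a \<in> W \<longrightarrow> c \<in> W"
      using count_msum_le[OF AB(1) that(1)] count_msum_le[OF AB(2) that(2)]
        cnt[of a] cnt[of c] ac fin by simp
    then show ?thesis using that by blast
  qed
  then show ?thesis
  proof cases
    case 1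
    then show ?thesis
      using decrease_one_side[OF XY(1,2) AB sum ac(1-3)] reach.refl by metis
  next
    case 2
    have "\<exists>Y' B'. reach \<B> (add_mset Y B) (add_mset Y' B') \<and> card (Y' - X) < card (Y - X)"
      by (rule decrease_one_side[OF XY(2,1) AB(2,1) AB(3)[symmetric] sum[symmetric] ac(2,1,4) 2])
    then obtain Y' B' where *: "reach \<B> (add_mset Y B) (add_mset Y' B')" "card (Y' - X) < card (Y - X)"
      by blast
    have "Y' \<in> \<B>" using reach_bases[OF *(1)] XY AB by simp
    then have "card (X - Y') < card (X - Y)"
      using * basis_diff_card[of X Y'] basis_diff_card[of X Y] XY basis_card basis_subset by simp
    then show ?thesis using * reach.refl by metis
  qed
qed

section \<open>Joining two vertices\<close>

text \<open>A common endpoint is sought because moves occur on both sides. The outer induction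
  removes a common basis; the inner one decreases \<open>card (X - Y)\<close> until there is
  one.\<close>

lemma reach_joinable:
  assumes "set_mset A \<subseteq> \<B>" "set_mset B \<subseteq> \<B>" "size A = size B" "msum A = msum B"
  shows "\<exists>D. reach \<B> A D \<and> reach \<B> B D"
  using assms
proof (induction "size A" arbitrary: A B)
  case 0
  then show ?case using reach.refl by auto
next
  case (Suc n)
  have "\<exists>D. reach \<B> (add_mset X A') D \<and> reach \<B> (add_mset Y B') D"
    if "set_mset (add_mset X A') \<subseteq> \<B>" "set_mset (add_mset Y B') \<subseteq> \<B>" "size A' = n" "size B' = n"
      "msum (add_mset X A') = msum (add_mset Y B')" for X A' Y B'
    using that
  proof (induction "card (X - Y)" arbitrary: X A' Y B' rule: less_induct)
    case less
    show ?case
    proof (cases "X = Y")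
      case True
      then obtain D where "reach \<B> A' D" "reach \<B> B' D"
        using Suc.hyps(1)[of A' B'] less.prems by auto
      then show ?thesis using True reach_add_mset by blast
    next
      case False
      then obtain X' A'' Y' B'' where
        rA: "reach \<B> (add_mset X A') (add_mset X' A'')" and
        rB: "reach \<B> (add_mset Y B') (add_mset Y' B'')" and
        lt: "card (X' - Y') < card (X - Y)"
        using decrease[of X Y A' B'] less.prems by auto
      have fin: "\<forall>X\<in>\<B>. finite X" using basis_finite by blast
      have "\<exists>D. reach \<B> (add_mset X' A'') D \<and> reach \<B> (add_mset Y' B'') D"
      proof (rule less.hyps[OF lt])
        show "set_mset (add_mset X' A'') \<subseteq> \<B>" "set_mset (add_mset Y' B'') \<subseteq> \<B>"
          using reach_bases rA rB less.prems by blast+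
        show "size A'' = n" "size B'' = n"
          using reach_size[OF rA] reach_size[OF rB] less.prems by auto
        show "msum (add_mset X' A'') = msum (add_mset Y' B'')"
          using reach_msum[OF rA fin] reach_msum[OF rB fin] less.prems by simp
      qed
      then show ?thesis using rA rB reach_trans by blast
    qed
  qed
  moreover obtain X A' Y B' where "A = add_mset X A'" "B = add_mset Y B'"
    using Suc.hyps(2) Suc.prems(3) by (metis size_eq_Suc_imp_eq_union)
  ultimately show ?case using Suc by simp
qed

end

section \<open>Nonbases of sparse paving matroids\<close>

text \<open>An \<open>r\<close>-set \<open>X\<close> that is not a basis is a circuit-hyperplane. If
  \<open>Y = insert y (X - {t})\<close> is another, the independent set \<open>X - {t}\<close> has
  to extend to a basis inside \<open>insert y X\<close>, hence to \<open>X\<close> or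
  \<open>Y\<close>.\<close>

lemma sparse_paving_stable_nonbases:
  assumes sp: "sparse_paving E \<B>" and r: "m_rank \<B> E = r"
  shows "stable_nonbases E \<B> r"
proof -
  have mb: "matroid_bases E \<B>" using sp by (simp add: sparse_paving_def)
  have finE: "finite E" and ne: "\<B> \<noteq> {}" and sub: "\<And>B. B \<in> \<B> \<Longrightarrow> B \<subseteq> E"
    using mb by (auto simp: matroid_bases_def)
  have fin\<B>: "finite \<B>" using sub finE by (meson PowI finite_Pow_iff finite_subset subsetI)
  have fin: "finite B" if "B \<in> \<B>" for B using sub[OF that] finE finite_subset by blast
  have rank_le: "m_rank \<B> X \<le> n" if "\<And>B. B \<in> \<B> \<Longrightarrow> card (X \<inter> B) \<le> n" for X n
    unfolding m_rank_def using that fin\<B> ne by auto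
  have rank_attained: "\<exists>B\<in>\<B>. card (X \<inter> B) = m_rank \<B> X" for X
  proof -
    have "m_rank \<B> X \<in> (\<lambda>B. card (X \<inter> B)) ` \<B>"
      unfolding m_rank_def using fin\<B> ne by (intro Max_in) auto
    then show ?thesis by auto
  qed
  have card: "card B = r" if "B \<in> \<B>" for B
  proof -
    obtain B' where "B' \<in> \<B>" "card (E \<inter> B') = r" using rank_attained[of E] r by auto
    then show ?thesis
      using matroid_bases_card_eq[OF mb that, of B'] sub[of B'] by (simp add: Int_absorb1)
  qed
  have circuit_hyperplane: "(\<forall>x\<in>X. m_indep \<B> (X - {x})) \<and> m_hyperplane E \<B> X"
    if X: "X \<subseteq> E" "card X = r" "X \<notin> \<B>" for X
  proof -
    have finX: "finite X" using X finE finite_subset by blast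
    have dep: "\<not> m_indep \<B> X"
      using X card fin card_subset_eq unfolding m_indep_def by metis
    \<comment> \<open>A smallest dependent subset of \<open>X\<close> is a circuit. Its rank is
      below \<open>card C \<le> r\<close>, so it is a hyperplane of rank \<open>r - 1\<close>; hence
      \<open>card C = r\<close> and \<open>C = X\<close>.\<close>
    define C where "C = arg_min_on card {C. C \<subseteq> X \<and> \<not> m_indep \<B> C}"
    let ?D = "{C. C \<subseteq> X \<and> \<not> m_indep \<B> C}"
    have D: "finite ?D" "?D \<noteq> {}" using finX dep by auto
    have C: "C \<subseteq> X" "\<not> m_indep \<B> C"
      using arg_min_if_finite(1)[OF D, of card] unfolding C_def by auto
    have min: "\<not> (card C' < card C)" if "C' \<subseteq> X" "\<not> m_indep \<B> C'" for C'
      using arg_min_if_finite(2)[OF D, of card] that unfolding C_def by blast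
    have finC: "finite C" using C finX finite_subset by blast
    have "m_indep \<B> (C - {x})" if "x \<in> C" for x
      using min[of "C - {x}"] C that card_Diff1_less[OF finC that] by blast
    then have circ: "m_circuit E \<B> C" using C X by (auto simp: m_circuit_def)
    have lt: "m_rank \<B> C < card C"
    proof -
      obtain B where B: "B \<in> \<B>" "card (C \<inter> B) = m_rank \<B> C" using rank_attained by blast
      have "C \<inter> B \<subset> C" using B C by (auto simp: m_indep_def)
      then show ?thesis using B finC psubset_card_mono by metis
    qed
    have "card C \<le> r" using C finX X card_mono by metis
    then have hyper: "m_hyperplane E \<B> C"
      using sp circ lt r by (simp add: sparse_paving_def)
    then have "card C = r" using lt r \<open>card C \<le> r\<close> by (simp add: m_hyperplane_def)
    then have "C = X" using C X finX card_subset_eq by metis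
    then show ?thesis using circ hyper by (simp add: m_circuit_def)
  qed
  show ?thesis
  proof
    show "finite E" by (rule finE)
    show "B \<subseteq> E" "card B = r" if "B \<in> \<B>" for B using that sub card by auto
    show "Y \<in> \<B>"
      if X: "X \<subseteq> E" "card X = r" "X \<notin> \<B>" and Y: "Y \<subseteq> E" "card Y = r"
        and "X \<noteq> Y" "X - Y \<subseteq> {t}" for X Y t
    proof (rule ccontr)
      assume "Y \<notin> \<B>"
      have finXY: "finite X" "finite Y" using X Y finE finite_subset by blast+
      have "\<not> X \<subseteq> Y" using X Y \<open>X \<noteq> Y\<close> finXY card_subset_eq by metis
      then have XYt: "X - Y = {t}" using \<open>X - Y \<subseteq> {t}\<close> by blast
      have "card (Y - X) = card (X - Y)"
        using X Y finXY by (simp add: card_Diff_subset_Int Int_commute)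
      then obtain y where YX: "Y - X = {y}" using XYt by (metis card_1_singletonE is_singletonI is_singleton_altdef)
      have Yeq: "Y = insert y (X - {t})" using XYt YX by blast
      obtain B2 where B2: "B2 \<in> \<B>" "X - {t} \<subseteq> B2"
        using circuit_hyperplane[OF X] XYt unfolding m_indep_def by blast
      \<comment> \<open>Adding \<open>y\<close> to the hyperplane \<open>X\<close> raises the rank
        to \<open>r\<close>, so some basis lies inside \<open>insert y X\<close>.\<close>
      have "y \<in> E - X" using YX Y by blast
      then have "m_rank \<B> X < m_rank \<B> (insert y X)" "m_rank \<B> X + 1 = r"
        using circuit_hyperplane[OF X] r by (auto simp: m_hyperplane_def m_flat_def)
      then obtain B where B: "B \<in> \<B>" "r \<le> card (insert y X \<inter> B)"
        using rank_attained[of "insert y X"] by force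
      have Bsub: "B \<subseteq> insert y X"
        using B card[of B] fin[of B] by (metis card_seteq inf_le2 inf.orderE inf_commute)
      have t: "t \<in> X" using XYt by blast
      have "card (B2 - (X - {t})) = 1"
        using B2 card[of B2] fin[of B2] X finXY t \<open>m_rank \<B> X + 1 = r\<close> by (simp add: card_Diff_subset)
      then obtain w where w: "B2 - (X - {t}) = {w}" using card_1_singletonE by blast
      then have B2eq: "B2 = insert w (X - {t})" "w \<notin> X - {t}" using B2 by blast+
      have nt: "insert t (X - {t}) \<notin> \<B>" using X t by (simp add: insert_absorb)
      have ny: "insert y (X - {t}) \<notin> \<B>" using \<open>Y \<notin> \<B>\<close> Yeq by simp
      \<comment> \<open>Otherwise \<open>B2\<close> would be \<open>X\<close> or \<open>Y\<close>.
        Thus \<open>w \<notin> B\<close>, and exchanging \<open>w\<close> for an element of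
        \<open>B\<close> adds \<open>t\<close> or \<open>y\<close> to
        \<open>X - {t}\<close>.\<close>
      have "w \<noteq> t" "w \<noteq> y" using B2eq B2 nt ny by blast+
      then have "w \<in> B2 - B" using Bsub B2eq by blast
      then obtain u where u: "u \<in> B - B2" "insert u (B2 - {w}) \<in> \<B>"
        using mb B B2 unfolding matroid_bases_def by blast
      have "B2 - {w} = X - {t}" using B2eq by blast
      then have "insert u (X - {t}) \<in> \<B>" using u(2) by simp
      moreover have "u \<in> insert y X" "u \<notin> X - {t}" using u(1) Bsub B2(2) by blast+
      ultimately show False using nt ny by blast
    qed
  qed
qed

theorem theorem2p4:
  fixes E :: "'a set" and \<B> :: "'a set set" and r k :: nat and S :: "'a multiset"
  assumes "sparse_paving E \<B>"
    and "m_rank \<B> E = r"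
    and "k \<ge> 2"
    and "size S = k * r"
    and "set_mset S \<subseteq> E"
  shows "GM_connected \<B> k S"
  unfolding GM_connected_def
proof (intro ballI)
  interpret stable_nonbases E \<B> r
    using assms(1,2) by (rule sparse_paving_stable_nonbases)
  fix A B
  assume A: "A \<in> GM_vertices \<B> k S" and B: "B \<in> GM_vertices \<B> k S"
  then obtain D where "reach \<B> A D" "reach \<B> B D"
    using reach_joinable[of A B] by (auto simp: GM_vertices_def)
  then have AD: "(A, D) \<in> (GM_edges \<B> k S)\<^sup>*" and BD: "(B, D) \<in> (GM_edges \<B> k S)\<^sup>*"
    using reach_GM_edges A B basis_finite by blast+
  \<comment> \<open>Symmetry of the edges reverses the walk from \<open>B\<close> to the meeting
    point \<open>D\<close>.\<close>
  have "sym (GM_edges \<B> k S)" by (auto simp: sym_def GM_edges_def)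
  then have "(D, B) \<in> (GM_edges \<B> k S)\<^sup>*" using BD sym_rtrancl symD by metis
  with AD show "(A, B) \<in> (GM_edges \<B> k S)\<^sup>*" by (rule rtrancl_trans)
qed

end
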